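(* Let $\alpha\in\mathbb{Z}^{+}$, let $d$ be an integer with $0\le d<\alpha$, let $h\ge2$ be an integer that is odd or prime, and let $t$ be an integer with $0\le t\le h$. Then for all integers $n\ge0$, $$(\alpha n-d)!_{(\alpha)}\equiv\sum_{i=0}^{n}\binom{h}{i}\alpha^n(-\alpha)^{(t+1)i}\left(\frac{d}{\alpha}-h\right)_i\left(\frac{\alpha-d}{\alpha}\right)_{n-i}\pmod{h\alpha^t},$$ $$(\alpha n-d)!_{(\alpha)}\equiv\sum_{i=0}^{n}\binom{h}{i}(-\alpha)^n\alpha^{(t+1)i}\left(\frac{d}{\alpha}+n+1-h\right)_i\left(\frac{d}{\alpha}-n\right)_{n-i}\pmod{h\alpha^t}.$$
   Context: For $\alpha\in\mathbb{Z}^{+}$, the $\alpha$-factorial function $m!_{(\alpha)}$ of an integer $m$ is defined by $m!_{(\alpha)}=m\cdot(m-\alpha)!_{(\alpha)}$ if $m>0$, $m!_{(\alpha)}=1$ if $-\alpha<m\le0$, and $m!_{(\alpha)}=0$ otherwise. The symbol $(x)_n=x(x+1)\cdots(x+n-1)$ is the Pochhammer symbol (rising factorial), with $(x)_0=1$. *)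

theory Defs
  imports
    "HOL-Computational_Algebra.Primes"
    "HOL-Library.Real_Mod"
begin

text \<open>
  The conjunct \<open>0 < \<alpha>\<close> in the recursive branch only secures termination; the function is meant
  to be used for \<open>\<alpha> \<ge> 1\<close>.
\<close>

function alpha_fact :: "nat \<Rightarrow> int \<Rightarrow> int" where
  "alpha_fact \<alpha> m =
     (if 0 < \<alpha> \<and> 0 < m then m * alpha_fact \<alpha> (m - int \<alpha>)
      else if - int \<alpha> < m \<and> m \<le> 0 then 1
      else 0)"
  by pat_completeness auto
termination
  by (relation "measure (\<lambda>(\<alpha>, m). nat m)") auto

declare alpha_fact.simps [simp del]

lemma alpha_fact_pos:
  "0 < \<alpha> \<Longrightarrow> 0 < m \<Longrightarrow> alpha_fact \<alpha> m = m * alpha_fact \<alpha> (m - int \<alpha>)"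
  by (subst alpha_fact.simps) simp

lemma alpha_fact_base:
  "- int \<alpha> < m \<Longrightarrow> m \<le> 0 \<Longrightarrow> alpha_fact \<alpha> m = 1"
  by (subst alpha_fact.simps) simp

lemma alpha_fact_neg:
  "m \<le> - int \<alpha> \<Longrightarrow> alpha_fact \<alpha> m = 0"
  by (subst alpha_fact.simps) auto

text \<open>
  The Pochhammer symbols are taken at rational arguments, so congruences modulo a positive
  integer \<open>M\<close> are expressed by the relation \<open>[x = y] (rmod M)\<close> on the reals, which says that
  \<open>x\<close> and \<open>y\<close> differ by an integer multiple of \<open>M\<close>. On integers this is the usual congruence:
\<close>

lemma rcong_of_int_iff:
  fixes a b M :: int
  shows "[of_int a = of_int b] (rmod of_int M) \<longleftrightarrow> M dvd a - b"
proof -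
  have "[of_int a = of_int b] (rmod of_int M) \<longleftrightarrow> (\<exists>k. b = a + k * M)"
    unfolding rcong_altdef
    by (metis (no_types, lifting) of_int_add of_int_eq_iff of_int_mult)
  also have "\<dots> \<longleftrightarrow> M dvd b - a"
    by (auto simp: dvd_def algebra_simps)
  finally show ?thesis
    by (simp add: dvd_diff_commute)
qed

end

theory Submission
  imports Defs "HOL-Number_Theory.Cong"
begin

text \<open>
  In both sums the term with \<open>i = 0\<close> is exactly the \<open>\<alpha>\<close>-factorial: multiplying the Pochhammer
  symbol at \<open>y / \<alpha>\<close> through by powers of \<open>\<alpha>\<close> gives a product of \<open>n\<close> integers in arithmetic
  progression, which is \<open>(\<alpha> - d) (2 \<alpha> - d) \<dots> (\<alpha> n - d)\<close>, read upwards in the first sum and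
  downwards, with all signs reversed, in the second. The congruences say that every other term
  is an integer divisible by \<open>h \<alpha>\<^sup>t\<close>.

  For \<open>i \<ge> 1\<close> the power \<open>\<alpha>\<^bsup>(t + 1) i\<^esup>\<close> splits into \<open>\<alpha>\<^bsup>t i\<^esup>\<close>, a multiple of \<open>\<alpha>\<^sup>t\<close>, and a factor
  \<open>\<alpha>\<^sup>i\<close>. What remains is to find the factor \<open>h\<close>. The binomial coefficient need not supply it
  when \<open>h\<close> is composite, but \<open>i (h choose i) = h (h - 1 choose i - 1)\<close>, so it suffices that \<open>i\<close>
  divides \<open>\<alpha>\<^sup>i\<close> times a product of \<open>i\<close> terms \<open>x + \<alpha> k\<close>. This holds for every \<open>x\<close>: the part of
  \<open>i\<close> coprime to \<open>\<alpha>\<close> divides one of the terms of the progression, and the part built from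
  primes dividing \<open>\<alpha>\<close> divides \<open>\<alpha>\<^sup>i\<close> (lemma \<open>dvd_power_mult_progression\<close>).
\<close>

definition progression_prod :: "nat \<Rightarrow> int \<Rightarrow> nat \<Rightarrow> int" where
  "progression_prod a x m = (\<Prod>k<m. x + int a * int k)"

lemma power_mult_pochhammer_divide:
  assumes "0 < a"
  shows "real a ^ m * pochhammer (real_of_int x / real a) m = of_int (progression_prod a x m)"
proof -
  have "real a ^ m * pochhammer (real_of_int x / real a) m
      = (\<Prod>k<m. real a * (real_of_int x / real a + real k))"
    by (simp add: pochhammer_prod prod.distrib atLeast0LessThan)
  also have "\<dots> = of_int (progression_prod a x m)"
    using assms by (simp add: progression_prod_def distrib_left)
  finally show ?thesis .
qed

text \<open>
  Strong induction on \<open>m\<close> strips off the primes shared with \<open>a\<close>: each step removes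
  \<open>gcd m a > 1\<close> from \<open>m\<close> at the cost of one factor \<open>a\<close>, and makes \<open>m\<close> strictly smaller, so \<open>m\<close>
  factors are enough. Once \<open>m\<close> is coprime to \<open>a\<close>, the terms with \<open>k < m\<close> run through all
  residues modulo \<open>m\<close>.
\<close>

lemma dvd_power_mult_progression:
  fixes x :: int
  assumes "0 < m"
  shows "\<exists>k<m. int m dvd int a ^ m * (x + int a * int k)"
  using assms
proof (induction m rule: less_induct)
  case (less m)
  show ?case
  proof (cases "coprime a m")
    case True
    then obtain b where b: "[int a * b = 1] (mod int m)"
      using cong_solve_coprime_int[of "int a" "int m"] by auto
    define k where "k = nat ((- x * b) mod int m)"
    have k: "int k = (- x * b) mod int m" "k < m"
      using less.prems by (simp_all add: k_def nat_less_iff)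
    have "[x + int a * int k = x + int a * (- x * b)] (mod int m)"
      unfolding k(1) by (intro cong_add cong_mult cong_refl) (simp add: cong_def)
    also have "x + int a * (- x * b) = x - x * (int a * b)"
      by (simp add: algebra_simps)
    also have "[x - x * (int a * b) = x - x * 1] (mod int m)"
      using b by (intro cong_diff cong_mult cong_refl)
    finally have "int m dvd x + int a * int k"
      by (simp add: cong_0_iff)
    with k(2) show ?thesis
      by (metis dvd_mult)
  next
    case False
    define g where "g = gcd a m"
    have g: "1 < g" "g dvd a" "g dvd m"
      using False less.prems by (auto simp: g_def coprime_iff_gcd_eq_1 nat_neq_iff)
    then obtain m' where m': "m = g * m'"
      by blast
    have less_m: "m' < m" "0 < m'"
      using m' g(1) less.prems by auto
    then obtain k where k: "k < m'" "int m' dvd int a ^ m' * (x + int a * int k)"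
      using less.IH by blast
    have "int m dvd int a * (int a ^ m' * (x + int a * int k))"
      unfolding m' of_nat_mult using g(2) k(2) by (intro mult_dvd_mono) auto
    also have "\<dots> = int a ^ Suc m' * (x + int a * int k)"
      by simp
    also have "\<dots> dvd int a ^ m * (x + int a * int k)"
      using less_m(1) by (intro mult_dvd_mono le_imp_power_dvd) auto
    finally show ?thesis
      using k(1) less_m(1) by (meson less_trans)
  qed
qed

lemma dvd_power_mult_progression_prod:
  assumes "0 < i"
  shows "int i dvd int a ^ i * progression_prod a x i"
proof -
  obtain k where k: "k < i" "int i dvd int a ^ i * (x + int a * int k)"
    using dvd_power_mult_progression[OF assms] by blast
  have "x + int a * int k dvd progression_prod a x i"
    unfolding progression_prod_def using k(1) by (intro dvd_prodI) auto
  then show ?thesis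
    using k(2) by (meson dvd_refl dvd_trans mult_dvd_mono)
qed

text \<open>
  The absorption identity \<open>i (h choose i) = h (h - 1 choose i - 1)\<close> trades a divisor \<open>i\<close> of the
  remaining factors for the divisor \<open>h\<close>.
\<close>

lemma dvd_binomial_mult:
  fixes z :: int
  assumes "0 < i" and "int i dvd z"
  shows "int h dvd int (h choose i) * z"
proof -
  obtain w where w: "z = int i * w"
    using assms(2) by blast
  have "i * (h choose i) = h * ((h - 1) choose (i - 1))"
    using assms(1) by (rule times_binomial_minus1_eq)
  then have "int i * int (h choose i) = int h * int ((h - 1) choose (i - 1))"
    by (metis of_nat_mult)
  then have "int (h choose i) * z = int h * (int ((h - 1) choose (i - 1)) * w)"
    unfolding w by (metis mult.assoc mult.commute)
  then show ?thesis
    by simp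
qed

lemma dvd_binomial_power_progression_prod:
  assumes "0 < i"
  shows "int h * int a ^ t dvd int (h choose i) * int a ^ ((t + 1) * i) * progression_prod a x i"
proof -
  have "int a ^ ((t + 1) * i) = int a ^ i * int a ^ (t * i)"
    by (simp add: power_add)
  then have "int (h choose i) * int a ^ ((t + 1) * i) * progression_prod a x i
      = (int (h choose i) * (int a ^ i * progression_prod a x i)) * int a ^ (t * i)"
    by (simp add: mult_ac)
  moreover have "int h dvd int (h choose i) * (int a ^ i * progression_prod a x i)"
    using assms by (intro dvd_binomial_mult dvd_power_mult_progression_prod)
  moreover have "int a ^ t dvd int a ^ (t * i)"
    using assms by (intro le_imp_power_dvd) simp
  ultimately show ?thesis
    by (metis mult_dvd_mono)
qed

text \<open>
  The integers \<open>e\<close> and \<open>f\<close> stand for the signs, which differ between the two sums of the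
  theorem.
\<close>

lemma progression_prod_cong_binomial_sum:
  fixes x y e f :: int
  assumes "0 < a"
  shows "[of_int (e ^ n * progression_prod a y n) =
      (\<Sum>i=0..n. of_nat (h choose i) * (of_int e * real a) ^ n * (of_int f * real a) ^ ((t + 1) * i)
          * pochhammer (of_int x / real a) i * pochhammer (of_int y / real a) (n - i))]
    (rmod (real h * real a ^ t))"
proof -
  define T where "T i = e ^ n * f ^ ((t + 1) * i)
      * (int (h choose i) * int a ^ ((t + 1) * i) * progression_prod a x i)
      * progression_prod a y (n - i)" for i
  have T: "of_nat (h choose i) * (of_int e * real a) ^ n * (of_int f * real a) ^ ((t + 1) * i)
      * pochhammer (of_int x / real a) i * pochhammer (of_int y / real a) (n - i) = of_int (T i)"
    if "i \<le> n" for i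
  proof -
    \<comment> \<open>The factor \<open>a ^ n\<close> is exactly what clears the denominators of both Pochhammer symbols.\<close>
    have "real a ^ n = real a ^ i * real a ^ (n - i)"
      using that by (simp flip: power_add)
    then show ?thesis
      by (simp add: T_def power_mult_distrib mult_ac flip: power_mult_pochhammer_divide[OF assms])
  qed
  have "int h * int a ^ t dvd T i" if "0 < i" for i
    unfolding T_def by (intro dvd_mult dvd_mult2 dvd_binomial_power_progression_prod that)
  then have "int h * int a ^ t dvd (\<Sum>i=1..n. T i)"
    by (intro dvd_sum) auto
  moreover have "(\<Sum>i=0..n. T i) = e ^ n * progression_prod a y n + (\<Sum>i=1..n. T i)"
    by (simp add: sum.atLeast_Suc_atMost T_def progression_prod_def)
  ultimately have "int h * int a ^ t dvd e ^ n * progression_prod a y n - (\<Sum>i=0..n. T i)"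
    by simp
  then have "[of_int (e ^ n * progression_prod a y n) = of_int (\<Sum>i=0..n. T i)]
      (rmod of_int (int h * int a ^ t))"
    by (simp only: rcong_of_int_iff)
  moreover have "of_int (\<Sum>i=0..n. T i) =
      (\<Sum>i=0..n. of_nat (h choose i) * (of_int e * real a) ^ n * (of_int f * real a) ^ ((t + 1) * i)
          * pochhammer (of_int x / real a) i * pochhammer (of_int y / real a) (n - i))"
    unfolding of_int_sum by (intro sum.cong refl T[symmetric]) simp
  ultimately show ?thesis
    by simp
qed

lemma alpha_fact_eq_progression_prod:
  assumes "d < a"
  shows "alpha_fact a (int a * int n - int d) = progression_prod a (int a - int d) n"
proof (induction n)
  case 0
  then show ?case
    using assms by (simp add: alpha_fact_base progression_prod_def)
next
  case (Suc n)
  \<comment> \<open>The recursive clause applies because \<open>d < a\<close> keeps the argument positive.\<close>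
  have "d < a * Suc n"
    using assms by (simp add: trans_less_add1)
  then have "0 < int a * int (Suc n) - int d"
    by (metis diff_gt_0_iff_gt of_nat_less_iff of_nat_mult)
  moreover have "int a * int (Suc n) - int d - int a = int a * int n - int d"
    by (simp add: algebra_simps)
  ultimately have "alpha_fact a (int a * int (Suc n) - int d)
      = (int a * int (Suc n) - int d) * progression_prod a (int a - int d) n"
    using assms Suc.IH alpha_fact_pos by (metis gr_zeroI not_less_zero)
  then show ?case
    by (simp add: progression_prod_def algebra_simps)
qed

text \<open>Negating each term and reversing the order turns the progression into a shifted one.\<close>

lemma progression_prod_reverse:
  "(- 1) ^ n * progression_prod a (y - int a * int n) n = progression_prod a (int a - y) n"
proof -
  have "(- 1) ^ n * progression_prod a (y - int a * int n) n
      = (\<Prod>k<n. - (y - int a * int n + int a * int k))"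
    unfolding progression_prod_def by (simp only: prod_uminus card_lessThan)
  also have "\<dots> = (\<Prod>k<n. - (y - int a * int n + int a * int (n - Suc k)))"
    by (rule prod.nat_diff_reindex[symmetric])
  also have "\<dots> = progression_prod a (int a - y) n"
    unfolding progression_prod_def
    by (intro prod.cong refl) (simp add: of_nat_diff algebra_simps)
  finally show ?thesis .
qed

theorem corollary4:
  fixes \<alpha> d h t n :: nat
  assumes "0 < \<alpha>" and "d < \<alpha>"
    and "2 \<le> h" and "odd h \<or> prime h"
    and "t \<le> h"
  shows
    "[of_int (alpha_fact \<alpha> (int \<alpha> * int n - int d)) =
        (\<Sum>i=0..n. of_nat (h choose i) * real \<alpha> ^ n * (- real \<alpha>) ^ ((t + 1) * i)
            * pochhammer (real d / real \<alpha> - real h) i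
            * pochhammer ((real \<alpha> - real d) / real \<alpha>) (n - i))]
       (rmod (real h * real \<alpha> ^ t))
     \<and>
     [of_int (alpha_fact \<alpha> (int \<alpha> * int n - int d)) =
        (\<Sum>i=0..n. of_nat (h choose i) * (- real \<alpha>) ^ n * real \<alpha> ^ ((t + 1) * i)
            * pochhammer (real d / real \<alpha> + real n + 1 - real h) i
            * pochhammer (real d / real \<alpha> - real n) (n - i))]
       (rmod (real h * real \<alpha> ^ t))"
proof
  have x1: "of_int (int d - int \<alpha> * int h) / real \<alpha> = real d / real \<alpha> - real h"
    and y1: "of_int (int \<alpha> - int d) / real \<alpha> = (real \<alpha> - real d) / real \<alpha>"
    and x2: "of_int (int d + int \<alpha> * (int n + 1 - int h)) / real \<alpha>
      = real d / real \<alpha> + real n + 1 - real h"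
    and y2: "of_int (int d - int \<alpha> * int n) / real \<alpha> = real d / real \<alpha> - real n"
    using assms(1) by (simp_all add: field_simps)
  note fact = alpha_fact_eq_progression_prod[OF assms(2), of n]
  show "[of_int (alpha_fact \<alpha> (int \<alpha> * int n - int d)) =
      (\<Sum>i=0..n. of_nat (h choose i) * real \<alpha> ^ n * (- real \<alpha>) ^ ((t + 1) * i)
          * pochhammer (real d / real \<alpha> - real h) i
          * pochhammer ((real \<alpha> - real d) / real \<alpha>) (n - i))]
      (rmod (real h * real \<alpha> ^ t))"
    using progression_prod_cong_binomial_sum[OF assms(1), where e = 1 and f = "- 1"
        and x = "int d - int \<alpha> * int h" and y = "int \<alpha> - int d" and n = n and h = h and t = t]
    unfolding x1 y1 fact by simp
  show "[of_int (alpha_fact \<alpha> (int \<alpha> * int n - int d)) =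
      (\<Sum>i=0..n. of_nat (h choose i) * (- real \<alpha>) ^ n * real \<alpha> ^ ((t + 1) * i)
          * pochhammer (real d / real \<alpha> + real n + 1 - real h) i
          * pochhammer (real d / real \<alpha> - real n) (n - i))]
      (rmod (real h * real \<alpha> ^ t))"
    using progression_prod_cong_binomial_sum[OF assms(1), where e = "- 1" and f = 1
        and x = "int d + int \<alpha> * (int n + 1 - int h)" and y = "int d - int \<alpha> * int n"
        and n = n and h = h and t = t]
    unfolding x2 y2 fact progression_prod_reverse by simp
qed

end
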